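(* Let $A\in\mathbb{R}^{n_x\times n_x}$, $B\in\mathbb{R}^{n_x\times n_u}$ with $(A,B)$ controllable, let $Q\in\mathbb{R}^{n_x\times n_x}$ and $R\in\mathbb{R}^{n_u\times n_u}$ be symmetric positive definite, and let $0<\gamma\le 1$. Let $\pi(x)=-K^{\pi}x$, with $K^\pi\in\mathbb{R}^{n_u\times n_x}$, be a stabilizing policy for $x_{k+1}=Ax_k+Bu_k$, and let $H^\pi$ be the symmetric matrix representing the Q-function $Q^\pi$ of $\pi$. Let $H^\pi_0\in\mathbb{R}^{(n_x+n_u)\times(n_x+n_u)}$ be an arbitrary initial matrix, and for $i=0,1,2,\dots$ let $H^\pi_{i+1}$ be the symmetric matrix determined by requiring that $$\begin{bmatrix} x_k\\ u_k\end{bmatrix}^T H^\pi_{i+1}\begin{bmatrix} x_k\\ u_k\end{bmatrix}= x_k^TQx_k+u_k^TRu_k+\gamma\begin{bmatrix} x_{k+1}\\ u_{k+1}\end{bmatrix}^T H^\pi_i\begin{bmatrix} x_{k+1}\\ u_{k+1}\end{bmatrix}$$ for all $x_k\in\mathbb{R}^{n_x}$ and $u_k\in\mathbb{R}^{n_u}$, where $x_{k+1}=Ax_k+Bu_k$ and $u_{k+1}=\pi(x_{k+1})$. Then $H^\pi_i\to H^\pi$ as $i\to\infty$.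
   Context: The system is the discrete-time linear system $x_{k+1}=Ax_k+Bu_k$ with state $x_k\in\mathbb{R}^{n_x}$ and input $u_k\in\mathbb{R}^{n_u}$. A policy is a linear state feedback $u_k=\pi(x_k)=-K^\pi x_k$. It is stabilizing if every closed-loop trajectory $x_{k+1}=(A-BK^\pi)x_k$ converges to $0$. The local cost is $c(x,u)=x^TQx+u^TRu$. The value function of $\pi$ is $V^\pi(x_k)=\sum_{i=k}^{\infty}\gamma^{i-k}\left(x_i^TQx_i+u_i^TRu_i\right)$, where $u_i=\pi(x_i)$ and $x_{i+1}=Ax_i+Bu_i$ for $i\ge k$. The Q-function of $\pi$ is $Q^\pi(x,u)=c(x,u)+\gamma V^\pi(Ax+Bu)$ for all $x\in\mathbb{R}^{n_x}$, $u\in\mathbb{R}^{n_u}$ ($u$ arbitrary at the first step, $\pi$ followed afterwards). For a stabilizing policy $\pi$, $Q^\pi$ is a quadratic form, and $H^\pi\in\mathbb{R}^{(n_x+n_u)\times(n_x+n_u)}$ denotes the symmetric matrix with $Q^\pi(x,u)=\begin{bmatrix} x\\ u\end{bmatrix}^T H^\pi\begin{bmatrix} x\\ u\end{bmatrix}$ for all $x,u$. *)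

theory Defs
  imports "HOL-Analysis.Analysis"
begin

definition quad :: "real^'n^'n \<Rightarrow> real^'n \<Rightarrow> real" where
  "quad M z = z \<bullet> (M *v z)"

definition sym_matrix :: "real^'n^'n \<Rightarrow> bool" where
  "sym_matrix M \<longleftrightarrow> transpose M = M"

definition sym_pos_def :: "real^'n^'n \<Rightarrow> bool" where
  "sym_pos_def M \<longleftrightarrow> sym_matrix M \<and> (\<forall>z. z \<noteq> 0 \<longrightarrow> quad M z > 0)"

definition stack :: "real^'x \<Rightarrow> real^'u \<Rightarrow> real^('x + 'u)" where
  "stack x u = (\<chi> i. case i of Inl j \<Rightarrow> x $ j | Inr j \<Rightarrow> u $ j)"

primrec state :: "real^'x^'x \<Rightarrow> real^'u^'x \<Rightarrow> real^'x \<Rightarrow> (nat \<Rightarrow> real^'u) \<Rightarrow> nat \<Rightarrow> real^'x" where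
  "state A B x0 u 0 = x0"
| "state A B x0 u (Suc k) = A *v state A B x0 u k + B *v u k"

definition controllable :: "real^'x^'x \<Rightarrow> real^'u^'x \<Rightarrow> bool" where
  "controllable A B \<longleftrightarrow> (\<forall>x0 x1. \<exists>N u. state A B x0 u N = x1)"

definition policy :: "real^'x^'u \<Rightarrow> real^'x \<Rightarrow> real^'u" where
  "policy K x = - (K *v x)"

definition stabilizing :: "real^'x^'x \<Rightarrow> real^'u^'x \<Rightarrow> real^'x^'u \<Rightarrow> bool" where
  "stabilizing A B K \<longleftrightarrow>
     (\<forall>x. (\<forall>k. x (Suc k) = (A - B ** K) *v x k) \<longrightarrow> x \<longlonglongrightarrow> 0)"

primrec closed_loop :: "real^'x^'x \<Rightarrow> real^'u^'x \<Rightarrow> real^'x^'u \<Rightarrow> real^'x \<Rightarrow> nat \<Rightarrow> real^'x" where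
  "closed_loop A B K x 0 = x"
| "closed_loop A B K x (Suc i) =
     A *v closed_loop A B K x i + B *v policy K (closed_loop A B K x i)"

definition cost :: "real^'x^'x \<Rightarrow> real^'u^'u \<Rightarrow> real^'x \<Rightarrow> real^'u \<Rightarrow> real" where
  "cost Q R x u = quad Q x + quad R u"

text \<open>The system is time-invariant, so the value at time k depends only on the state at that
  time; the summation index below is the offset from k.\<close>

definition value_fun ::
  "real^'x^'x \<Rightarrow> real^'u^'x \<Rightarrow> real^'x^'x \<Rightarrow> real^'u^'u \<Rightarrow> real \<Rightarrow> real^'x^'u \<Rightarrow> real^'x \<Rightarrow> real" where
  "value_fun A B Q R \<gamma> K x =
     (\<Sum>i. \<gamma> ^ i * cost Q R (closed_loop A B K x i) (policy K (closed_loop A B K x i)))"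

definition q_fun ::
  "real^'x^'x \<Rightarrow> real^'u^'x \<Rightarrow> real^'x^'x \<Rightarrow> real^'u^'u \<Rightarrow> real \<Rightarrow> real^'x^'u
     \<Rightarrow> real^'x \<Rightarrow> real^'u \<Rightarrow> real" where
  "q_fun A B Q R \<gamma> K x u = cost Q R x u + \<gamma> * value_fun A B Q R \<gamma> K (A *v x + B *v u)"

text \<open>A symmetric matrix is determined by its quadratic form, so the description below is
  meaningful as soon as \<open>f\<close> is a quadratic form in the stacked vector.\<close>

definition form_matrix :: "(real^'x \<Rightarrow> real^'u \<Rightarrow> real) \<Rightarrow> real^('x + 'u)^('x + 'u)" where
  "form_matrix f = (THE H. sym_matrix H \<and> (\<forall>x u. quad H (stack x u) = f x u))"

definition q_matrix ::
  "real^'x^'x \<Rightarrow> real^'u^'x \<Rightarrow> real^'x^'x \<Rightarrow> real^'u^'u \<Rightarrow> real \<Rightarrow> real^'x^'u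
     \<Rightarrow> real^('x + 'u)^('x + 'u)" where
  "q_matrix A B Q R \<gamma> K = form_matrix (q_fun A B Q R \<gamma> K)"

text \<open>\<open>H0\<close> need not be symmetric; all later iterates are.\<close>

primrec q_iter ::
  "real^'x^'x \<Rightarrow> real^'u^'x \<Rightarrow> real^'x^'x \<Rightarrow> real^'u^'u \<Rightarrow> real \<Rightarrow> real^'x^'u
     \<Rightarrow> real^('x + 'u)^('x + 'u) \<Rightarrow> nat \<Rightarrow> real^('x + 'u)^('x + 'u)" where
  "q_iter A B Q R \<gamma> K H0 0 = H0"
| "q_iter A B Q R \<gamma> K H0 (Suc i) =
     form_matrix (\<lambda>x u. cost Q R x u +
       \<gamma> * quad (q_iter A B Q R \<gamma> K H0 i)
               (stack (A *v x + B *v u) (policy K (A *v x + B *v u))))"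

end

theory Submission
  imports Defs
begin

text \<open>Unrolling the recursion gives \<open>quad H\<^sub>i\<close> as the cost of following the policy for finitely many
  steps plus a discounted terminal form in \<open>H0\<close>. A linear map whose iterates tend pointwise to \<open>0\<close>
  has absolutely summable orbits, so the cost converges to the Q-function and the terminal form
  vanishes. A symmetric matrix is read off from its quadratic form by polarization, so pointwise
  convergence of the forms is convergence of the matrices; it also shows that the Q-function,
  as a pointwise limit of quadratic forms, is itself one.\<close>

subsection \<open>Quadratic forms\<close>

text \<open>Expanding the form at \<open>axis i 1 + axis j 1\<close> leaves the cross terms
  \<open>M $ i $ j + M $ j $ i\<close>, which symmetry merges.\<close>

lemma sym_matrix_polarization:
  fixes M :: "real^'n^'n"
  assumes "sym_matrix M"
  shows "M $ i $ j = (quad M (axis i 1 + axis j 1) - quad M (axis i 1) - quad M (axis j 1)) / 2"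
proof -
  have entry: "axis k 1 \<bullet> (M *v axis l 1) = M $ k $ l" for k l
    by (simp add: inner_axis' matrix_vector_mul_component inner_axis)
  have "M $ j $ i = M $ i $ j"
    using arg_cong[OF assms[unfolded sym_matrix_def], of "\<lambda>N. N $ i $ j"]
    by (simp add: transpose_def)
  then show ?thesis
    by (simp add: quad_def matrix_vector_right_distrib inner_add_left inner_add_right entry)
qed

lemma sym_matrix_eqI:
  assumes "sym_matrix M" "sym_matrix N" "\<And>z. quad M z = quad N z"
  shows "M = N"
  using assms by (simp add: vec_eq_iff sym_matrix_polarization)

text \<open>Each entry of \<open>X n\<close> is a fixed linear combination of three values of its
  form, so the entries converge; continuity of \<open>quad\<close> in the matrix then identifies
  \<open>f\<close> as the form of the limit.\<close>

lemma quad_tendsto_imp_matrix_tendsto: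
  fixes X :: "nat \<Rightarrow> real^'n^'n"
  assumes sym: "\<And>n. sym_matrix (X n)"
    and lim: "\<And>z. (\<lambda>n. quad (X n) z) \<longlonglongrightarrow> f z"
  obtains H where "sym_matrix H" "\<And>z. quad H z = f z" "X \<longlonglongrightarrow> H"
proof -
  define H :: "real^'n^'n"
    where "H = (\<chi> i j. (f (axis i 1 + axis j 1) - f (axis i 1) - f (axis j 1)) / 2)"
  have "(\<lambda>n. X n $ i $ j) \<longlonglongrightarrow> H $ i $ j" for i j
    unfolding sym_matrix_polarization[OF sym] H_def vec_lambda_beta
    by (intro tendsto_intros lim) auto
  then have X: "X \<longlonglongrightarrow> H"
    by (intro vec_tendstoI)
  have "(\<lambda>n. quad (X n) z) \<longlonglongrightarrow> quad H z" for z
    unfolding quad_def inner_vec_def matrix_vector_mult_def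
    by (intro tendsto_intros X)
  then have "quad H z = f z" for z
    using lim LIMSEQ_unique by blast
  moreover have "sym_matrix H"
    by (simp add: sym_matrix_def transpose_def H_def vec_eq_iff add.commute)
  ultimately show ?thesis
    using X that by blast
qed

text \<open>Symmetry is not demanded of the matrix, so closure properties need only exhibit some
  matrix; symmetrization comes once, afterwards.\<close>

definition quadratic_form :: "(real^'n \<Rightarrow> real) \<Rightarrow> bool" where
  "quadratic_form f \<longleftrightarrow> (\<exists>M. \<forall>z. f z = quad M z)"

lemma quadratic_form_add:
  assumes "quadratic_form f" "quadratic_form g"
  shows "quadratic_form (\<lambda>z. f z + g z)"
proof -
  obtain M N where "\<And>z. f z = quad M z" "\<And>z. g z = quad N z"
    using assms unfolding quadratic_form_def by blast
  then have "f z + g z = quad (M + N) z" for z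
    by (simp add: quad_def matrix_vector_mult_add_rdistrib inner_add_right)
  then show ?thesis
    unfolding quadratic_form_def by blast
qed

lemma quadratic_form_scale:
  assumes "quadratic_form f"
  shows "quadratic_form (\<lambda>z. c * f z)"
proof -
  obtain M where "\<And>z. f z = quad M z"
    using assms unfolding quadratic_form_def by blast
  then have "c * f z = quad (c *\<^sub>R M) z" for z
    by (simp add: quad_def scaleR_matrix_vector_assoc[symmetric])
  then show ?thesis
    unfolding quadratic_form_def by blast
qed

lemma quadratic_form_linear:
  fixes L :: "real^'n \<Rightarrow> real^'m"
  assumes "linear L"
  shows "quadratic_form (\<lambda>z. quad M (L z))"
proof -
  have "quad M (L z) = quad (transpose (matrix L) ** (M ** matrix L)) z" for z
    using fun_cong[OF matrix_vector_mul(2)[OF assms], of z] dot_lmul_matrix[of z "transpose (matrix L)"]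
    by (simp only: quad_def matrix_vector_mul_assoc[symmetric] vector_transpose_matrix)
  then show ?thesis
    unfolding quadratic_form_def by blast
qed

lemma quadratic_form_sym_matrix:
  assumes "quadratic_form f"
  obtains H where "sym_matrix H" "\<And>z. quad H z = f z"
proof -
  obtain M where M: "\<And>z. f z = quad M z"
    using assms unfolding quadratic_form_def by blast
  \<comment> \<open>\<open>M\<close> and its transpose have the same form, hence so does their
    mean.\<close>
  define H where "H = (1/2) *\<^sub>R (M + transpose M)"
  have "sym_matrix H"
    by (simp add: sym_matrix_def H_def transpose_def vec_eq_iff add.commute)
  moreover have "quad H z = f z" for z
    using dot_lmul_matrix[of z M z]
    by (simp add: M H_def quad_def scaleR_matrix_vector_assoc[symmetric]
        matrix_vector_mult_add_rdistrib inner_add_right inner_commute[of z "z v* M"])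
  ultimately show ?thesis
    using that by blast
qed

subsection \<open>Stacked vectors\<close>

text \<open>With \<open>lower\<close>, the inverse of \<open>stack\<close>: functions of a pair
  become functions of one vector, to which \<open>quadratic_form\<close> applies.\<close>

definition upper :: "real^('x::finite + 'u::finite) \<Rightarrow> real^'x" where
  "upper z = (\<chi> j. z $ Inl j)"

definition lower :: "real^('x::finite + 'u::finite) \<Rightarrow> real^'u" where
  "lower z = (\<chi> j. z $ Inr j)"

lemma stack_upper_lower [simp]: "stack (upper z) (lower z) = z"
  by (simp add: stack_def upper_def lower_def vec_eq_iff split: sum.split)

lemma upper_stack [simp]: "upper (stack x u) = x"
  by (simp add: stack_def upper_def vec_eq_iff)

lemma lower_stack [simp]: "lower (stack x u) = u"
  by (simp add: stack_def lower_def vec_eq_iff)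

lemma linear_upper: "linear upper"
  by (auto intro!: linearI simp: upper_def vec_eq_iff)

lemma linear_lower: "linear lower"
  by (auto intro!: linearI simp: lower_def vec_eq_iff)

lemma linear_stack:
  assumes "linear f" "linear g"
  shows "linear (\<lambda>z. stack (f z) (g z))"
  by (rule linearI)
    (auto simp: stack_def vec_eq_iff linear_add[OF assms(1)] linear_add[OF assms(2)]
      linear_scale[OF assms(1)] linear_scale[OF assms(2)] split: sum.split)

text \<open>Every vector is a stack, so \<open>f\<close> fixes the whole form, and polarization
  makes the symmetric matrix unique.\<close>

lemma form_matrix_eqI:
  assumes "sym_matrix H" "\<And>x u. quad H (stack x u) = f x u"
  shows "form_matrix f = H"
  unfolding form_matrix_def
proof (rule the_equality)
  fix H' assume H': "sym_matrix H' \<and> (\<forall>x u. quad H' (stack x u) = f x u)"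
  have "quad H' z = quad H z" for z
    using H' assms(2) stack_upper_lower[of z] by metis
  then show "H' = H"
    using H' assms(1) sym_matrix_eqI by blast
qed (use assms in blast)

lemma form_matrix_quadratic_form:
  assumes "quadratic_form (\<lambda>z. f (upper z) (lower z))"
  shows "sym_matrix (form_matrix f)" "quad (form_matrix f) (stack x u) = f x u"
proof -
  obtain H where H: "sym_matrix H" "\<And>z. quad H z = f (upper z) (lower z)"
    using quadratic_form_sym_matrix[OF assms] by blast
  then have "form_matrix f = H"
    by (intro form_matrix_eqI) auto
  with H show "sym_matrix (form_matrix f)" "quad (form_matrix f) (stack x u) = f x u"
    by auto
qed

subsection \<open>Orbits of a stable linear map\<close>

text \<open>In finite dimension the norms on the basis, summed, bound the operator norm, so
  pointwise convergence is uniform on the unit ball.\<close>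

lemma linear_tendsto_zero_uniform:
  fixes T :: "nat \<Rightarrow> 'a::euclidean_space \<Rightarrow> 'b::real_normed_vector"
  assumes lin: "\<And>n. linear (T n)" and lim: "\<And>x. (\<lambda>n. T n x) \<longlonglongrightarrow> 0" and "e > 0"
  shows "\<forall>\<^sub>F n in sequentially. \<forall>x. norm (T n x) \<le> e * norm x"
proof -
  have "(\<lambda>n. \<Sum>b\<in>Basis. norm (T n b)) \<longlonglongrightarrow> (\<Sum>b\<in>(Basis::'a set). 0)"
    by (intro tendsto_sum tendsto_norm_zero lim)
  then have "\<forall>\<^sub>F n in sequentially. (\<Sum>b\<in>Basis. norm (T n b)) < e"
    using \<open>e > 0\<close> by (auto intro: order_tendstoD)
  then show ?thesis
  proof eventually_elim
    case (elim n)
    show ?case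
    proof
      fix x
      have "norm (T n x) = norm (\<Sum>b\<in>Basis. (x \<bullet> b) *\<^sub>R T n b)"
        by (subst euclidean_representation[of x, symmetric])
          (simp only: linear_sum[OF lin] linear_scale[OF lin])
      also have "\<dots> \<le> (\<Sum>b\<in>Basis. norm x * norm (T n b))"
        by (intro order_trans[OF norm_sum] sum_mono)
          (auto intro!: mult_right_mono Basis_le_norm)
      also have "\<dots> \<le> norm x * e"
        using elim by (auto simp: sum_distrib_left[symmetric] intro!: mult_left_mono)
      finally show "norm (T n x) \<le> e * norm x"
        by (simp add: mult.commute)
    qed
  qed
qed

text \<open>A partial sum is at most its first \<open>m\<close> terms plus half of itself, hence at
  most twice the sum of those terms.\<close>

lemma summable_if_shift_halves:
  fixes a :: "nat \<Rightarrow> real"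
  assumes nonneg: "\<And>i. 0 \<le> a i" and half: "\<And>i. a (i + m) \<le> a i / 2"
  shows "summable a"
proof (rule bounded_imp_summable[where B = "2 * sum a {..<m}"])
  fix n
  have "sum a {..<k + m} = sum a {..<m} + (\<Sum>i<k. a (i + m))" for k
    by (induction k) auto
  moreover have "(\<Sum>i<Suc n. a (i + m)) \<le> sum a {..<Suc n} / 2"
    unfolding sum_divide_distrib by (intro sum_mono half)
  moreover have "sum a {..<Suc n} \<le> sum a {..<Suc n + m}"
    using nonneg by (intro sum_mono2) auto
  ultimately have "sum a {..<Suc n} \<le> 2 * sum a {..<m}"
    by (smt (verit) field_sum_of_halves)
  then show "sum a {..n} \<le> 2 * sum a {..<m}"
    by (simp only: lessThan_Suc_atMost)
qed (rule nonneg)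

text \<open>By uniformity a single power \<open>f ^^ m\<close> halves every norm, so the norms along
  an orbit halve every \<open>m\<close> steps.\<close>

lemma summable_norm_funpow:
  fixes f :: "'a::euclidean_space \<Rightarrow> 'a"
  assumes "linear f" and lim: "\<And>x. (\<lambda>n. (f ^^ n) x) \<longlonglongrightarrow> 0"
  shows "summable (\<lambda>n. norm ((f ^^ n) x))"
proof -
  have "linear (f ^^ n)" for n
    by (induction n) (simp_all only: funpow.simps linear_id linear_compose[OF _ assms(1)])
  then have "\<forall>\<^sub>F n in sequentially. \<forall>x. norm ((f ^^ n) x) \<le> 1/2 * norm x"
    by (intro linear_tendsto_zero_uniform lim) auto
  then obtain m where m: "\<And>x. norm ((f ^^ m) x) \<le> 1/2 * norm x"
    using eventually_happens'[OF sequentially_bot] by blast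
  have "norm ((f ^^ (i + m)) x) \<le> norm ((f ^^ i) x) / 2" for i
    using m[of "(f ^^ i) x"] by (simp add: add.commute[of i] funpow_add)
  then show ?thesis
    by (intro summable_if_shift_halves) auto
qed

text \<open>Summability comes from \<open>w\<close> rather than from the discount, so \<gamma> = 1
  is covered: the form is at most a multiple of the squared norm, which is below the norm once the
  latter is less than 1.\<close>

lemma summable_discounted_quad:
  fixes w :: "nat \<Rightarrow> real^'n" and \<gamma> :: real
  assumes w: "summable (\<lambda>i. norm (w i))" and "0 \<le> \<gamma>" "\<gamma> \<le> 1"
  shows "summable (\<lambda>i. \<gamma> ^ i * quad M (w i))"
proof -
  obtain C where "0 < C" and C: "\<And>x. norm (M *v x) \<le> norm x * C"
    using bounded_linear.pos_bounded[OF matrix_vector_mul_bounded_linear] by blast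
  have "\<forall>\<^sub>F i in sequentially. norm (w i) < 1"
    using summable_LIMSEQ_zero[OF w] by (rule order_tendstoD) simp
  then have "\<forall>\<^sub>F i in sequentially. norm (\<gamma> ^ i * quad M (w i)) \<le> C * norm (w i)"
  proof eventually_elim
    case (elim i)
    have "norm (\<gamma> ^ i * quad M (w i)) \<le> 1 * norm (quad M (w i))"
      using assms(2,3) unfolding norm_mult by (intro mult_right_mono) (auto simp: power_le_one)
    also have "norm (quad M (w i)) \<le> norm (w i) * norm (M *v w i)"
      unfolding quad_def real_norm_def by (rule Cauchy_Schwarz_ineq2)
    also have "\<dots> \<le> 1 * (norm (w i) * C)"
      using elim \<open>0 < C\<close> by (intro mult_mono C) auto
    finally show ?case
      by (simp add: mult.commute)
  qed
  then show ?thesis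
    by (rule summable_comparison_test_ev) (intro summable_mult w)
qed

subsection \<open>The closed loop\<close>

lemma linear_policy: "linear (policy K)"
  unfolding policy_def by (intro linear_compose_neg matrix_vector_mul_linear)

lemma closed_loop_eq_funpow: "closed_loop A B K x i = ((*v) (A - B ** K) ^^ i) x"
  by (induction i)
    (auto simp: policy_def matrix_vector_mult_diff_rdistrib matrix_vector_mul_assoc[symmetric]
      vec.neg)

text \<open>Allows unrolling a recursion that refers to the next state.\<close>

lemma closed_loop_Suc_shift:
  "closed_loop A B K (A *v x + B *v policy K x) i = closed_loop A B K x (Suc i)"
  by (induction i) auto

lemma stabilizing_summable_norm:
  assumes "stabilizing A B K"
  shows "summable (\<lambda>i. norm (closed_loop A B K x i))"
proof -
  have "(\<lambda>n. ((*v) (A - B ** K) ^^ n) x) \<longlonglongrightarrow> 0" for x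
    using assms unfolding stabilizing_def by auto
  then show ?thesis
    unfolding closed_loop_eq_funpow by (intro summable_norm_funpow) auto
qed

lemma quadratic_form_stack_policy:
  "quadratic_form (\<lambda>x. quad G (stack x (policy K x)))"
  by (intro quadratic_form_linear linear_stack linear_policy linear_ident)

lemma quadratic_form_cost_policy:
  "quadratic_form (\<lambda>x. cost Q R x (policy K x))"
  unfolding cost_def
  by (intro quadratic_form_add quadratic_form_linear linear_policy linear_ident)

lemma summable_discounted_quadratic_form:
  assumes "quadratic_form g" "stabilizing A B K" "0 \<le> \<gamma>" "\<gamma> \<le> 1"
  shows "summable (\<lambda>i. \<gamma> ^ i * g (closed_loop A B K x i))"
proof -
  obtain M where "\<And>z. g z = quad M z"
    using assms(1) unfolding quadratic_form_def by blast
  then show ?thesis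
    using assms by (simp add: summable_discounted_quad stabilizing_summable_norm)
qed

section \<open>The iteration and its limit\<close>

lemma q_iter_Suc:
  fixes A :: "real^'x^'x" and B :: "real^'u^'x"
  shows "sym_matrix (q_iter A B Q R \<gamma> K H0 (Suc n))"
    and "quad (q_iter A B Q R \<gamma> K H0 (Suc n)) (stack x u) = cost Q R x u +
       \<gamma> * quad (q_iter A B Q R \<gamma> K H0 n)
               (stack (A *v x + B *v u) (policy K (A *v x + B *v u)))"
proof -
  have next_state: "linear (\<lambda>z. A *v upper z + B *v lower z)"
    using linear_compose[OF linear_upper matrix_vector_mul_linear[of A]]
      linear_compose[OF linear_lower matrix_vector_mul_linear[of B]]
    unfolding o_def by (rule linear_compose_add)
  have "linear (\<lambda>z. stack (A *v upper z + B *v lower z)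
      (policy K (A *v upper z + B *v lower z)))"
    using linear_compose[OF next_state linear_policy]
    unfolding o_def by (intro linear_stack next_state)
  \<comment> \<open>\<open>G\<close> stands for any previous iterate, symmetric or not, so the
    description in \<open>form_matrix\<close> is met at every step without induction.\<close>
  then have "quadratic_form (\<lambda>z. cost Q R (upper z) (lower z) + \<gamma> * quad G
      (stack (A *v upper z + B *v lower z) (policy K (A *v upper z + B *v lower z))))" for G
    unfolding cost_def
    by (intro quadratic_form_add quadratic_form_scale quadratic_form_linear
        linear_upper linear_lower)
  from form_matrix_quadratic_form[OF this]
  show "sym_matrix (q_iter A B Q R \<gamma> K H0 (Suc n))"
    and "quad (q_iter A B Q R \<gamma> K H0 (Suc n)) (stack x u) = cost Q R x u +
       \<gamma> * quad (q_iter A B Q R \<gamma> K H0 n)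
               (stack (A *v x + B *v u) (policy K (A *v x + B *v u)))"
    by simp_all
qed

text \<open>The recursion evaluates the previous form only at pairs that follow the policy, so
  restricted to such pairs it can be unrolled completely.\<close>

lemma quad_q_iter_policy:
  "quad (q_iter A B Q R \<gamma> K H0 n) (stack x (policy K x)) =
     (\<Sum>i<n. \<gamma> ^ i * cost Q R (closed_loop A B K x i) (policy K (closed_loop A B K x i))) +
     \<gamma> ^ n * quad H0 (stack (closed_loop A B K x n) (policy K (closed_loop A B K x n)))"
proof (induction n arbitrary: x)
  case (Suc n)
  show ?case
    unfolding q_iter_Suc(2) Suc.IH closed_loop_Suc_shift sum.lessThan_Suc_shift
    by (simp add: algebra_simps sum_distrib_left)
qed simp

text \<open>The terminal form is a quadratic form of the state, hence the general term of a
  convergent series, and vanishes in the limit.\<close>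

lemma quad_q_iter_policy_tendsto:
  assumes "stabilizing A B K" "0 \<le> \<gamma>" "\<gamma> \<le> 1"
  shows "(\<lambda>n. quad (q_iter A B Q R \<gamma> K H0 n) (stack x (policy K x)))
    \<longlonglongrightarrow> value_fun A B Q R \<gamma> K x"
proof -
  note summable = summable_discounted_quadratic_form[OF _ assms]
  show ?thesis
    unfolding quad_q_iter_policy value_fun_def
    using tendsto_add[OF
        summable_LIMSEQ[OF summable[OF quadratic_form_cost_policy]]
        summable_LIMSEQ_zero[OF summable[OF quadratic_form_stack_policy]]]
    by simp
qed

theorem lemma1:
  fixes A :: "real^'x^'x" and B :: "real^'u^'x"
    and Q :: "real^'x^'x" and R :: "real^'u^'u"
    and \<gamma> :: real and K :: "real^'x^'u"
    and H0 :: "real^('x + 'u)^('x + 'u)"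
  assumes "controllable A B"
    and "sym_pos_def Q" and "sym_pos_def R"
    and "0 < \<gamma>" and "\<gamma> \<le> 1"
    and "stabilizing A B K"
  shows "(\<lambda>i. q_iter A B Q R \<gamma> K H0 i) \<longlonglongrightarrow> q_matrix A B Q R \<gamma> K"
proof -
  let ?H = "q_iter A B Q R \<gamma> K H0"
  \<comment> \<open>One step of the recursion frees the first input \<open>u\<close>; from the next
    state on the policy is followed.\<close>
  have lim: "(\<lambda>n. quad (?H (Suc n)) (stack x u)) \<longlonglongrightarrow> q_fun A B Q R \<gamma> K x u" for x u
    unfolding q_iter_Suc(2) q_fun_def
    using assms by (intro tendsto_intros quad_q_iter_policy_tendsto) auto
  have "(\<lambda>n. quad (?H (Suc n)) z) \<longlonglongrightarrow> q_fun A B Q R \<gamma> K (upper z) (lower z)" for z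
    using lim[of "upper z" "lower z"] by (simp del: q_iter.simps)
  \<comment> \<open>The index is shifted because \<open>H0\<close> may fail to be symmetric.\<close>
  from quad_tendsto_imp_matrix_tendsto[of "\<lambda>n. ?H (Suc n)", OF q_iter_Suc(1) this]
  obtain H where H: "sym_matrix H" "\<And>z. quad H z = q_fun A B Q R \<gamma> K (upper z) (lower z)"
    and "(\<lambda>n. ?H (Suc n)) \<longlonglongrightarrow> H"
    by blast
  moreover have "q_matrix A B Q R \<gamma> K = H"
    unfolding q_matrix_def using H by (intro form_matrix_eqI) auto
  ultimately show ?thesis
    by (simp only: LIMSEQ_imp_Suc[of ?H])
qed

end
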